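(* Let $d\ge1$ and $0<\alpha<1$. Let $u_0\in L^\infty(\mathbb R^d)$ be compactly supported, nonnegative, not identically zero and radially non-increasing, let $M=\|u_0\|_{L^1(\mathbb R^d)}$, and let $u$ be the solution by characteristics with rarefaction fans with datum $u_0$ (defined in the context). Let $$U_M(t,x)=t^{-\frac1\alpha}\left(\alpha+\left(\frac{\omega_d|x|^dt^{-\frac1\alpha}}{\alpha M}\right)^{\frac\alpha{1-\alpha}}\right)^{-\frac1\alpha}.$$ Then, for every fixed $t>0$, $$\frac{u(t,x)-U_M(t,x)}{U_M(t,x)}\longrightarrow0\qquad\text{as }|x|\to+\infty.$$
   Context: $\omega_d$ is the volume of the unit ball of $\mathbb R^d$; radial functions on $\mathbb R^d$ are identified with functions of the volume variable $\rho=\omega_d|x|^d\ge0$. For a nonnegative, bounded, non-increasing $u_0:[0,\infty)\to[0,\infty)$, $u_0\not\equiv0$, let $m_0(\rho)=\int_0^\rho u_0(s)\,ds$, let $u_0(\rho^\pm)$ be the one-sided limits (with $u_0(0^-):=u_0(0^+)$), and let $D=\{(\rho_0,\eta_0):\rho_0\ge0,\ \eta_0>0,\ \eta_0\in[u_0(\rho_0^+),u_0(\rho_0^-)]\}$. For $t>0$ the map $P_t:D\to[0,+\infty)$, $P_t(\rho_0,\eta_0)=\rho_0+\alpha m_0(\rho_0)\eta_0^{\alpha-1}t$, is a bijection. The solution by characteristics with rarefaction fans with datum $u_0$ is $u(t,x)=(\eta_0^{-\alpha}+\alpha t)^{-1/\alpha}$ with $(\rho_0,\eta_0)=P_t^{-1}(\omega_d|x|^d)$,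 $t>0$. *)

theory Defs
  imports "HOL-Analysis.Analysis"
begin

definition vol_coord :: "'a::euclidean_space \<Rightarrow> real" where
  "vol_coord x = measure lborel (ball (0::'a) 1) * norm x ^ DIM('a)"

text \<open>A radially non-increasing datum is an almost-everywhere class of functions that has a
  representative of the form \<open>v \<circ> vol_coord\<close> with \<open>v\<close> non-increasing on the half-line.
  Values of \<open>v\<close> at negative arguments are irrelevant throughout.\<close>

definition radial_profile :: "(real \<Rightarrow> real) \<Rightarrow> ('a::euclidean_space \<Rightarrow> real) \<Rightarrow> bool" where
  "radial_profile v u0 \<longleftrightarrow>
     antimono_on {0..} v \<and> (AE x in lebesgue. u0 x = v (vol_coord x))"

definition mass_fn :: "(real \<Rightarrow> real) \<Rightarrow> real \<Rightarrow> real" where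
  "mass_fn v \<rho> = (LBINT s:{0..\<rho>}. v s)"

definition right_lim :: "(real \<Rightarrow> real) \<Rightarrow> real \<Rightarrow> real" where
  "right_lim v \<rho> = Lim (at_right \<rho>) v"

definition left_lim :: "(real \<Rightarrow> real) \<Rightarrow> real \<Rightarrow> real" where
  "left_lim v \<rho> = (if \<rho> = 0 then right_lim v 0 else Lim (at_left \<rho>) v)"

definition char_dom :: "(real \<Rightarrow> real) \<Rightarrow> (real \<times> real) set" where
  "char_dom v = {(\<rho>, \<eta>). \<rho> \<ge> 0 \<and> \<eta> > 0 \<and> \<eta> \<in> {right_lim v \<rho>..left_lim v \<rho>}}"

definition char_map :: "real \<Rightarrow> (real \<Rightarrow> real) \<Rightarrow> real \<Rightarrow> real \<times> real \<Rightarrow> real" where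
  "char_map \<alpha> v t = (\<lambda>(\<rho>, \<eta>). \<rho> + \<alpha> * mass_fn v \<rho> * \<eta> powr (\<alpha> - 1) * t)"

text \<open>The solution by characteristics with rarefaction fans. For \<open>t > 0\<close>, \<open>0 < \<alpha> < 1\<close> and a
  nonnegative non-increasing profile \<open>v\<close> that does not vanish almost everywhere on the half-line,
  \<open>char_map \<alpha> v t\<close> is a bijection from \<open>char_dom v\<close> onto \<open>{0..}\<close>, so that \<open>inv_into\<close> is a genuine
  inverse there.\<close>

definition fan_solution :: "real \<Rightarrow> (real \<Rightarrow> real) \<Rightarrow> real \<Rightarrow> 'a::euclidean_space \<Rightarrow> real" where
  "fan_solution \<alpha> v t x =
     (let (\<rho>, \<eta>) = inv_into (char_dom v) (char_map \<alpha> v t) (vol_coord x)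
      in (\<eta> powr (- \<alpha>) + \<alpha> * t) powr (- 1 / \<alpha>))"

definition selfsim_profile :: "real \<Rightarrow> real \<Rightarrow> real \<Rightarrow> 'a::euclidean_space \<Rightarrow> real" where
  "selfsim_profile \<alpha> M t x =
     t powr (- 1 / \<alpha>) *
     (\<alpha> + (vol_coord x * t powr (- 1 / \<alpha>) / (\<alpha> * M)) powr (\<alpha> / (1 - \<alpha>))) powr (- 1 / \<alpha>)"

end

theory Submission
  imports Defs
begin

text \<open>Let \<open>R\<close> be the edge of the support of the profile, so that \<open>M\<close> is the mass in \<open>[0, R]\<close>. A
  characteristic that reaches a far point \<open>y\<close> at time \<open>t\<close> starts at some \<open>(r, e)\<close> with \<open>r \<le> R\<close> and
  \<open>e\<close> small, and since \<open>e\<close> is at least the right limit of the profile at \<open>r\<close>, the foot \<open>r\<close> tends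
  to \<open>R\<close>; hence the mass \<open>m r\<close> in \<open>[0, r]\<close> tends to \<open>M\<close>. Solving \<open>y = r + \<alpha> m r e\<^sup>\<alpha>\<^sup>-\<^sup>1 t\<close> for \<open>e\<close> gives the same
  expression as in the self-similar profile, with \<open>y - r\<close> and \<open>m r\<close> in place of \<open>y\<close> and \<open>M\<close>; the
  quotients \<open>(y - r) / y\<close> and \<open>M / m r\<close> tend to \<open>1\<close>.\<close>

section \<open>The volume coordinate and its image measure\<close>

lemma borel_measurable_antimono_on_atLeast:
  fixes v :: "real \<Rightarrow> real"
  assumes "antimono_on {a..} v"
  shows "(\<lambda>s. v (max a s)) \<in> borel_measurable borel"
proof -
  have "mono (\<lambda>s. - v (max a s))"
    using assms by (auto simp: mono_def monotone_on_def)
  from borel_measurable_uminus[OF borel_measurable_mono[OF this]] show ?thesis by simp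
qed

lemma measure_unit_ball_pos: "measure lborel (ball (0::'a::euclidean_space) 1) > 0"
  using content_ball_pos[of 1 "0::'a"] by simp

lemma borel_measurable_vol_coord [measurable]: "vol_coord \<in> borel_measurable borel"
  unfolding vol_coord_def by measurable

lemma vol_coord_nonneg: "vol_coord x \<ge> 0"
  unfolding vol_coord_def by simp

lemma vol_coord_pos: "x \<noteq> 0 \<Longrightarrow> vol_coord x > 0"
  for x :: "'a::euclidean_space"
  unfolding vol_coord_def using measure_unit_ball_pos[where 'a='a] by simp

lemma vol_coord_at_top: "filterlim (vol_coord :: 'a::euclidean_space \<Rightarrow> real) at_top at_infinity"
  unfolding vol_coord_def
  by (intro filterlim_tendsto_pos_mult_at_top[OF tendsto_const] filterlim_pow_at_top
      filterlim_norm_at_top measure_unit_ball_pos) simp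

lemma vol_coord_le_iff:
  fixes x :: "'a::euclidean_space"
  assumes "a \<ge> 0"
  shows "vol_coord x \<le> a \<longleftrightarrow> x \<in> cball 0 (root DIM('a) (a / measure lborel (ball (0::'a) 1)))"
proof -
  let ?w = "measure lborel (ball (0::'a) 1)"
  have "vol_coord x \<le> a \<longleftrightarrow> norm x ^ DIM('a) \<le> a / ?w"
    using measure_unit_ball_pos[where 'a='a] by (simp add: vol_coord_def field_simps)
  also have "\<dots> \<longleftrightarrow> root DIM('a) (norm x ^ DIM('a)) \<le> root DIM('a) (a / ?w)"
    by (subst real_root_le_iff) auto
  also have "root DIM('a) (norm x ^ DIM('a)) = norm x"
    by (rule real_root_power_cancel) auto
  finally show ?thesis by simp
qed

lemma emeasure_vol_coord_le:
  assumes "a \<ge> 0"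
  shows "emeasure lborel {x::'a::euclidean_space. vol_coord x \<le> a} = ennreal a"
proof -
  let ?w = "measure lborel (ball (0::'a) 1)"
  let ?r = "root DIM('a) (a / ?w)"
  have "?r \<ge> 0" using assms by (simp add: measure_unit_ball_pos less_imp_le)
  have "{x::'a. vol_coord x \<le> a} = cball 0 ?r"
    using vol_coord_le_iff[OF assms] by blast
  then have "emeasure lborel {x::'a. vol_coord x \<le> a} = ennreal (measure lborel (cball (0::'a) ?r))"
    using emeasure_lborel_cball_finite[of "0::'a" ?r] by (simp add: emeasure_eq_ennreal_measure)
  also have "measure lborel (cball (0::'a) ?r) = ?r ^ DIM('a) * ?w"
    using content_ball_conv_unit_ball[OF \<open>?r \<ge> 0\<close>, of "0::'a"] content_cball_conv_ball[of "0::'a" ?r]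
    by simp
  also have "\<dots> = a"
    using measure_unit_ball_pos[where 'a='a] assms by simp
  finally show ?thesis .
qed

text \<open>The sets \<open>{..a}\<close> are intersection-stable and generate the Borel sets, so
  comparing the two measures on them suffices. There the left side is the volume of a ball, which
  the normalisation by the unit ball makes equal to \<open>a\<close>; this replaces polar
  coordinates.\<close>

lemma distr_vol_coord:
  "distr lborel borel (vol_coord :: 'a::euclidean_space \<Rightarrow> real) = density lborel (indicator {0..})"
    (is "?M = ?N")
proof -
  \<comment> \<open>\<open>ennreal a\<close> is 0 for negative \<open>a\<close>, so one formula also
    covers the sublevel sets that are empty.\<close>
  have M: "emeasure ?M {..a} = ennreal a" for a
  proof (cases "a \<ge> 0")
    case True
    then show ?thesis
      using emeasure_vol_coord_le[OF True, where 'a='a] by (simp add: emeasure_distr vimage_def)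
  next
    case False
    then have "vol_coord -` {..a} = ({} :: 'a set)"
      using vol_coord_nonneg[where 'a='a] order_trans by blast
    then show ?thesis using False by (simp add: emeasure_distr ennreal_neg)
  qed
  have N: "emeasure ?N {..a} = ennreal a" for a
  proof -
    have "emeasure ?N {..a} = emeasure lborel ({0..} \<inter> {..a})"
      by (subst emeasure_density) (simp_all flip: indicator_inter_arith)
    also have "{0..} \<inter> {..a} = {0..a}" by auto
    finally show ?thesis by (cases "a \<ge> 0") (auto simp: ennreal_neg)
  qed
  have sets: "sets borel = sigma_sets UNIV (range (\<lambda>a::real. {..a}))"
    by (subst borel_eq_atMost) simp
  show ?thesis
  proof (rule measure_eqI_generator_eq[where E = "range (\<lambda>a. {..a})" and \<Omega> = UNIV
        and A = "\<lambda>i. {..real i}"])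
    show "Int_stable (range (\<lambda>a::real. {..a}))"
      by (auto simp: Int_stable_def)
    show "(\<Union>i. {..real i}) = UNIV"
      by (auto intro: real_arch_simple)
  qed (auto simp: M N sets)
qed

text \<open>Change of variables along the image measure. Measurability is asked only of the cut-off
  to the half-line, because profiles are arbitrary at negative arguments.\<close>

lemma integral_radial:
  fixes f :: "real \<Rightarrow> real"
  assumes "(\<lambda>s. indicator {0..} s * f s) \<in> borel_measurable borel"
  shows "(LINT x::'a::euclidean_space|lborel. f (vol_coord x)) = (LBINT s:{0..}. f s)"
proof -
  let ?g = "\<lambda>s. indicator {0..} s * f s"
  have "(LINT x::'a|lborel. f (vol_coord x)) = (LINT x::'a|lborel. ?g (vol_coord x))"
    by (simp add: vol_coord_nonneg)
  also have "\<dots> = (LINT s|distr lborel borel (vol_coord :: 'a \<Rightarrow> real). ?g s)"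
    using assms by (subst integral_distr) auto
  also have "\<dots> = (LINT s|density lborel (\<lambda>s. ennreal (indicator {0..} s)). ?g s)"
    by (simp add: distr_vol_coord ennreal_indicator)
  also have "\<dots> = (LBINT s:{0..}. f s)"
    using assms unfolding set_lebesgue_integral_def
    by (subst integral_density) (auto intro!: Bochner_Integration.integral_cong split: split_indicator)
  finally show ?thesis .
qed

section \<open>Points at which an almost-everywhere property holds\<close>

lemma AE_lebesgue_in_open:
  fixes S :: "'a::euclidean_space set"
  assumes "AE x in lebesgue. P x" "open S" "S \<noteq> {}"
  shows "\<exists>x\<in>S. P x"
proof (rule ccontr)
  assume "\<not> ?thesis"
  moreover obtain N where "{x \<in> space lebesgue. \<not> P x} \<subseteq> N" "N \<in> null_sets lebesgue"
    using assms(1) unfolding eventually_ae_filter by blast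
  ultimately have "negligible S"
    by (auto simp flip: negligible_iff_null_sets intro: negligible_subset[of N])
  with assms(2,3) open_not_negligible show False by blast
qed

text \<open>The datum determines \<open>v \<circ> vol_coord\<close> only almost everywhere.
  Arbitrarily far points where the relation holds are enough, since monotonicity carries the
  information back to every smaller argument.\<close>

lemma ex_vol_coord_gt:
  assumes "AE x::'a::euclidean_space in lebesgue. P x"
  shows "\<exists>x. vol_coord x > a \<and> P x"
proof -
  have "eventually (\<lambda>x::'a. vol_coord x > a) at_infinity"
    using vol_coord_at_top by (auto simp: filterlim_at_top_dense)
  then obtain b where b: "\<And>x::'a. norm x \<ge> b \<Longrightarrow> vol_coord x > a"
    unfolding eventually_at_infinity by blast
  obtain z :: 'a where "norm z = \<bar>b\<bar> + 1"
    using vector_choose_size[of "\<bar>b\<bar> + 1"] by auto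
  then have "- cball (0::'a) b \<noteq> {}" by (auto simp: set_eq_iff intro!: exI[of _ z])
  moreover have "open (- cball (0::'a) b)" by (simp add: open_Compl)
  ultimately obtain x where "x \<in> - cball 0 b" "P x"
    using AE_lebesgue_in_open[OF assms] by blast
  with b[of x] show ?thesis by auto
qed

text \<open>\<open>R\<close> is the supremum of the set where \<open>v\<close> is positive. That
  supremum may or may not be attained, so \<open>v R\<close> is left free. Nonnegativity follows
  from monotonicity and the zeros beyond \<open>R\<close>.\<close>

locale compact_profile =
  fixes v :: "real \<Rightarrow> real" and R :: real
  assumes antimono: "antimono_on {0..} v"
    and R_pos: "R > 0"
    and pos: "\<And>s. 0 \<le> s \<Longrightarrow> s < R \<Longrightarrow> v s > 0"
    and zero: "\<And>s. s > R \<Longrightarrow> v s = 0"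
begin

section \<open>Mass and one-sided limits of a profile\<close>

lemma decr: "0 \<le> a \<Longrightarrow> a \<le> b \<Longrightarrow> v b \<le> v a"
  using antimono by (auto simp: monotone_on_def)

lemma nonneg: "0 \<le> s \<Longrightarrow> v s \<ge> 0"
  using decr[of s "max s (R + 1)"] zero[of "max s (R + 1)"] by simp

lemma borel_measurable_cut: "S \<in> sets borel \<Longrightarrow> S \<subseteq> {0..} \<Longrightarrow> (\<lambda>s. indicator S s * v s) \<in> borel_measurable borel"
proof -
  assume [measurable]: "S \<in> sets borel" and "S \<subseteq> {0..}"
  note [measurable] = borel_measurable_antimono_on_atLeast[OF antimono]
  \<comment> \<open>Extending \<open>v\<close> by the constant \<open>v 0\<close> to the left makes
    it monotone on the whole line, and the indicator hides the change.\<close>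
  have "(\<lambda>s. indicator S s * v s) = (\<lambda>s. indicator S s * v (max 0 s))"
    using \<open>S \<subseteq> {0..}\<close> by (auto simp: fun_eq_iff split: split_indicator)
  then show ?thesis by simp
qed

lemma set_integrable_profile: "set_integrable lborel {0..b} v"
  unfolding set_integrable_def
proof (rule Bochner_Integration.integrable_bound)
  show "integrable lborel (\<lambda>s::real. indicator {0..b} s *\<^sub>R v 0)"
    by (intro integrable_scaleR_left integrable_real_indicator) (auto simp: emeasure_lborel_Icc_eq)
  show "(\<lambda>s. indicator {0..b} s *\<^sub>R v s) \<in> borel_measurable lborel"
    using borel_measurable_cut[of "{0..b}"] by simp
qed (use decr nonneg in \<open>auto split: split_indicator\<close>)

lemma integrable_on_profile: "0 \<le> a \<Longrightarrow> v integrable_on {a..b}"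
  using set_borel_integral_eq_integral(1)[OF set_integrable_profile[of b]]
  by (rule integrable_on_subinterval) auto

lemma mass_eq: "mass_fn v b = integral {0..b} v"
  unfolding mass_fn_def by (rule set_borel_integral_eq_integral(2)[OF set_integrable_profile])

lemma mass_diff:
  assumes "0 \<le> a" "a \<le> b"
  shows "mass_fn v b - mass_fn v a = integral {a..b} v"
  using Henstock_Kurzweil_Integration.integral_combine[of 0 a b v] integrable_on_profile[of 0 b] assms by (simp add: mass_eq)

lemma mass_diff_le:
  assumes "0 \<le> a" "a \<le> b"
  shows "mass_fn v b - mass_fn v a \<le> (b - a) * v a"
proof -
  have "integral {a..b} v \<le> integral {a..b} (\<lambda>s. v a)"
    using assms decr by (intro integral_le integrable_on_profile) auto
  then show ?thesis using assms by (simp add: mass_diff)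
qed

lemma mass_diff_ge:
  assumes "0 \<le> a" "a \<le> b"
  shows "(b - a) * v b \<le> mass_fn v b - mass_fn v a"
proof -
  have "integral {a..b} (\<lambda>s. v b) \<le> integral {a..b} v"
    using assms decr by (intro integral_le integrable_on_profile) auto
  then show ?thesis using assms by (simp add: mass_diff)
qed

lemma mass_mono: "0 \<le> a \<Longrightarrow> a \<le> b \<Longrightarrow> mass_fn v a \<le> mass_fn v b"
  using mass_diff_ge[of a b] nonneg[of b] mult_nonneg_nonneg[of "b - a" "v b"] by linarith

lemma mass_0: "mass_fn v 0 = 0"
  by (simp add: mass_eq)

lemma mass_pos:
  assumes "s > 0"
  shows "mass_fn v s > 0"
proof -
  \<comment> \<open>Capping at \<open>R / 2\<close> keeps \<open>?r\<close> strictly below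
    \<open>R\<close>, so a rectangle of positive height \<open>v ?r\<close> fits under the
    graph.\<close>
  let ?r = "min s (R / 2)"
  have "0 < ?r * v ?r" using assms R_pos by (intro mult_pos_pos pos) auto
  also have "\<dots> \<le> mass_fn v ?r" using mass_diff_ge[of 0 ?r] assms R_pos by (simp add: mass_0)
  also have "\<dots> \<le> mass_fn v s" using assms R_pos by (intro mass_mono) auto
  finally show ?thesis .
qed

lemma total_eq: "mass_fn v R = (LBINT s:{0..}. v s)"
  unfolding mass_fn_def set_lebesgue_integral_def
proof (rule integral_cong_AE)
  show "AE s in lborel. indicator {0..R} s *\<^sub>R v s = indicator {0..} s *\<^sub>R v s"
    using AE_lborel_singleton[of R] by eventually_elim (use zero in \<open>auto split: split_indicator\<close>)
qed (use borel_measurable_cut in auto)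

lemma continuous_on_mass: "continuous_on {0..} (mass_fn v)"
proof (rule lipschitz_on_continuous_on)
  have *: "\<bar>mass_fn v a - mass_fn v b\<bar> \<le> v 0 * \<bar>a - b\<bar>" if "0 \<le> a" "a \<le> b" for a b
  proof -
    have "(b - a) * v a \<le> (b - a) * v 0" using that decr[of 0 a] by (intro mult_left_mono) auto
    then show ?thesis
      using that mass_mono[of a b] mass_diff_le[of a b] by (simp add: mult.commute)
  qed
  show "(v 0)-lipschitz_on {0..} (mass_fn v)"
  proof (rule lipschitz_onI)
    fix a b :: real assume "a \<in> {0..}" "b \<in> {0..}"
    then show "dist (mass_fn v a) (mass_fn v b) \<le> v 0 * dist a b"
      using *[of a b] *[of b a] by (cases "a \<le> b") (auto simp: dist_real_def abs_minus_commute)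
  qed (use nonneg in auto)
qed

text \<open>\<open>right_lim\<close> is a \<open>Lim\<close>, which is informative only once a limit
  exists. Existence comes from monotone convergence, applied to the increasing function
  \<open>- v (max 0 s)\<close>.\<close>

lemma tendsto_right_lim:
  assumes "r \<ge> 0"
  shows "(v \<longlongrightarrow> right_lim v r) (at_right r)"
proof -
  let ?f = "\<lambda>s. - v (max 0 s)"
  have "\<exists>l. (?f \<longlongrightarrow> l) (at_right r)"
    using Lim_right_bound[of UNIV r ?f "- v 0"] decr by fastforce
  then obtain l where "(?f \<longlongrightarrow> l) (at_right r)" by blast
  from tendsto_minus[OF this] have "((\<lambda>s. v (max 0 s)) \<longlongrightarrow> - l) (at_right r)" by simp
  moreover have "eventually (\<lambda>s. v (max 0 s) = v s) (at_right r)"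
    using eventually_at_right_less by eventually_elim (use assms in simp)
  ultimately have "(v \<longlongrightarrow> - l) (at_right r)"
    by (rule Lim_transform_eventually)
  then show ?thesis
    unfolding right_lim_def by (simp add: tendsto_Lim)
qed

lemma tendsto_left_lim:
  assumes "r > 0"
  shows "(v \<longlongrightarrow> left_lim v r) (at_left r)"
proof -
  let ?f = "\<lambda>s. - v (max 0 s)"
  have "\<exists>l. (?f \<longlongrightarrow> l) (at_left r)"
    using Lim_left_bound[of UNIV r ?f 0] decr nonneg by fastforce
  then obtain l where "(?f \<longlongrightarrow> l) (at_left r)" by blast
  from tendsto_minus[OF this] have "((\<lambda>s. v (max 0 s)) \<longlongrightarrow> - l) (at_left r)" by simp
  moreover have "eventually (\<lambda>s. v (max 0 s) = v s) (at_left r)"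
    using eventually_at_left_real[OF assms] by eventually_elim simp
  ultimately have "(v \<longlongrightarrow> - l) (at_left r)"
    by (rule Lim_transform_eventually)
  then show ?thesis
    unfolding left_lim_def using assms by (simp add: tendsto_Lim)
qed

lemma le_right_lim:
  assumes "0 \<le> r" "r < s"
  shows "v s \<le> right_lim v r"
proof (rule tendsto_lowerbound[OF tendsto_right_lim[OF assms(1)]])
  show "eventually (\<lambda>x. v s \<le> v x) (at_right r)"
    using eventually_at_right_real[OF assms(2)] by eventually_elim (use assms decr in auto)
qed simp

lemma left_lim_beyond:
  assumes "r > R"
  shows "left_lim v r = 0"
proof -
  have "eventually (\<lambda>x. v x = 0) (at_left r)"
    using eventually_at_left_real[OF assms] by eventually_elim (use zero in auto)
  then have "(v \<longlongrightarrow> 0) (at_left r)" by (simp add: tendsto_eventually)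
  with tendsto_left_lim[of r] assms R_pos show ?thesis
    by (intro tendsto_unique[of "at_left r" v]) auto
qed

section \<open>Characteristics that reach far points\<close>

lemma char_dom_le: "(r, e) \<in> char_dom v \<Longrightarrow> r \<le> R"
  using left_lim_beyond[of r] by (fastforce simp: char_dom_def)

text \<open>\<open>inv_into\<close> is meaningful only at attained values, so far points must be
  shown to be attained. The second bound on \<open>y\<close> says that the characteristic from
  \<open>(R / 2, v (R / 2))\<close> has not passed \<open>y\<close>, which gives the crossing search
  a starting point.\<close>

lemma char_map_onto:
  assumes \<alpha>: "0 < \<alpha>" "\<alpha> < 1" and t: "t > 0"
    and y: "y > R" "y \<ge> char_map \<alpha> v t (R / 2, v (R / 2))"
  shows "y \<in> char_map \<alpha> v t ` char_dom v"
proof -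
  define Q where "Q = (\<lambda>r. (y - r) / (\<alpha> * mass_fn v r * t))"
  \<comment> \<open>\<open>H r\<close> is the only value \<open>e\<close> for which the characteristic issued from \<open>(r, e)\<close> passes
    through \<open>y\<close>. As \<open>H\<close> increases and \<open>v\<close> decreases, the admissible \<open>r\<close> is their crossing point.\<close>
  define H where "H = (\<lambda>r. Q r powr (1 / (\<alpha> - 1)))"
  have Q_pos: "Q r > 0" if "0 < r" "r < y" for r
    unfolding Q_def using that mass_pos \<alpha> t by (intro divide_pos_pos mult_pos_pos) auto
  have H_pos: "H r > 0" if "0 < r" "r < y" for r
    unfolding H_def using Q_pos[OF that] by simp
  have H_mono: "H r \<le> H s" if "0 < r" "r \<le> s" "s < y" for r s
  proof -
    have "Q s \<le> Q r"
      unfolding Q_def using that mass_pos mass_mono \<alpha> t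
      by (intro frac_le mult_right_mono mult_left_mono mult_pos_pos) auto
    then show ?thesis
      unfolding H_def using Q_pos[of s] that \<alpha> by (intro powr_mono2') auto
  qed
  have H_powr: "H r powr (\<alpha> - 1) = Q r" if "0 < r" "r < y" for r
    unfolding H_def using Q_pos[OF that] \<alpha> by (simp add: powr_powr)
  have H_cont: "isCont H r" if "0 < r" "r < y" for r
  proof -
    have "isCont (mass_fn v) r"
      using continuous_on_interior[OF continuous_on_mass] that by simp
    then show ?thesis
      unfolding H_def Q_def using mass_pos[of r] Q_pos[OF that] that \<alpha> t
      by (intro continuous_intros) (auto simp: Q_def)
  qed
  \<comment> \<open>The crossing point is \<open>Sup S\<close>. The set is bounded by
    \<open>R\<close>, because \<open>H\<close> is positive where \<open>v\<close> already
    vanishes.\<close>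
  define S where "S = {r. 0 < r \<and> r < y \<and> H r \<le> v r}"
  have S_le: "r \<le> R" if "r \<in> S" for r
    using that H_pos[of r] zero[of r] unfolding S_def by fastforce
  have half: "R / 2 \<in> S"
  proof -
    let ?r = "R / 2"
    have r: "0 < ?r" "?r < y" using y(1) R_pos by auto
    \<comment> \<open>This is the second bound on \<open>y\<close> solved for the power; the
      negative exponent \<open>1 / (\<alpha> - 1)\<close> then reverses the inequality.\<close>
    have "v ?r powr (\<alpha> - 1) \<le> Q ?r"
      using y(2) mass_pos[OF r(1)] \<alpha> t
      by (simp add: Q_def char_map_def field_simps)
    then have "H ?r \<le> (v ?r powr (\<alpha> - 1)) powr (1 / (\<alpha> - 1))"
      unfolding H_def using pos[of ?r] R_pos \<alpha> by (intro powr_mono2') auto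
    also have "\<dots> = v ?r"
      using pos[of ?r] R_pos \<alpha> by (simp add: powr_powr)
    finally show ?thesis using r by (simp add: S_def)
  qed
  define c where "c = Sup S"
  have bdd: "bdd_above S" using S_le by (intro bdd_aboveI)
  have "R / 2 \<le> c" unfolding c_def using half bdd by (rule cSup_upper)
  moreover have "c \<le> R" unfolding c_def using half S_le by (intro cSup_least) auto
  ultimately have c: "0 < c" "c < y" using y(1) R_pos by auto
  have below: "H r \<le> v r" if r: "0 < r" "r < c" for r
  proof -
    obtain s where "s \<in> S" "r < s"
      using less_cSupD[of S r] half r(2) unfolding c_def by blast
    then show ?thesis
      using H_mono[of r s] decr[of r s] r(1) unfolding S_def by auto
  qed
  have above: "v r \<le> H r" if "c < r" "r < y" for r
    using cSup_upper[OF _ bdd, of r] that c unfolding c_def S_def by fastforce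
  \<comment> \<open>\<open>H\<close> is continuous at \<open>c\<close> while \<open>v\<close> may
    jump there. Passing to the limit from either side places \<open>H c\<close> in the closed jump
    interval of \<open>v\<close>, so a rarefaction fan is covered as well.\<close>
  have "H c \<le> left_lim v c"
  proof (rule tendsto_le)
    show "(v \<longlongrightarrow> left_lim v c) (at_left c)" using c by (intro tendsto_left_lim)
    show "(H \<longlongrightarrow> H c) (at_left c)"
      using H_cont[OF c] by (auto simp: isCont_def filterlim_at_split)
    show "eventually (\<lambda>r. H r \<le> v r) (at_left c)"
      using eventually_at_left_real[OF c(1)] by eventually_elim (use below in auto)
  qed simp
  moreover have "right_lim v c \<le> H c"
  proof (rule tendsto_le)
    show "(v \<longlongrightarrow> right_lim v c) (at_right c)" using c by (intro tendsto_right_lim) auto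
    show "(H \<longlongrightarrow> H c) (at_right c)"
      using H_cont[OF c] by (auto simp: isCont_def filterlim_at_split)
    show "eventually (\<lambda>r. v r \<le> H r) (at_right c)"
      using eventually_at_right_real[OF c(2)] by eventually_elim (use above in auto)
  qed simp
  ultimately have "(c, H c) \<in> char_dom v"
    using c H_pos[OF c] by (simp add: char_dom_def)
  moreover have "char_map \<alpha> v t (c, H c) = y"
    using mass_pos[OF c(1)] \<alpha> t by (simp add: char_map_def H_powr[OF c] Q_def)
  ultimately show ?thesis by (metis image_eqI)
qed

text \<open>A foot with \<open>r \<le> R - \<delta>\<close> has
  \<open>e \<ge> right_lim v r \<ge> v (R - \<delta> / 2) > 0\<close>, which bounds the distance
  travelled. The half of \<open>\<delta>\<close> leaves room on both sides: the sample point is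
  strictly right of \<open>r\<close>, as a right limit requires, and strictly left of
  \<open>R\<close>, where \<open>v\<close> is positive.\<close>

lemma char_foot_near_edge:
  assumes \<alpha>: "0 < \<alpha>" "\<alpha> < 1" and t: "t > 0" and \<delta>: "0 < \<delta>" "\<delta> < R"
    and dom: "(r, e) \<in> char_dom v"
    and y: "char_map \<alpha> v t (r, e) > R + \<alpha> * mass_fn v R * v (R - \<delta> / 2) powr (\<alpha> - 1) * t"
  shows "r > R - \<delta>"
proof (rule ccontr)
  assume "\<not> r > R - \<delta>"
  then have r: "r < R - \<delta> / 2" "r \<le> R" "0 \<le> r"
    using \<delta> dom char_dom_le by (auto simp: char_dom_def)
  have "v (R - \<delta> / 2) \<le> e"
    using le_right_lim[of r "R - \<delta> / 2"] r dom by (auto simp: char_dom_def)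
  then have "e powr (\<alpha> - 1) \<le> v (R - \<delta> / 2) powr (\<alpha> - 1)"
    using pos[of "R - \<delta> / 2"] \<delta> \<alpha> by (intro powr_mono2') auto
  then have "r + \<alpha> * mass_fn v r * e powr (\<alpha> - 1) * t
      \<le> R + \<alpha> * mass_fn v R * v (R - \<delta> / 2) powr (\<alpha> - 1) * t"
    using r mass_mono[of r R] mass_mono[of 0 r] mass_0 \<alpha> t
    by (intro add_mono mult_right_mono mult_mono) auto
  then show False using y by (simp add: char_map_def)
qed

section \<open>Asymptotics of the foot and of the solution\<close>

context
  fixes \<alpha> t :: real and foot :: "real \<Rightarrow> real \<times> real"
  assumes \<alpha>: "0 < \<alpha>" "\<alpha> < 1" and t: "t > 0"
  defines "foot \<equiv> inv_into (char_dom v) (char_map \<alpha> v t)"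
begin

lemma eventually_foot:
  "eventually (\<lambda>y. foot y \<in> char_dom v \<and> char_map \<alpha> v t (foot y) = y) at_top"
  using eventually_gt_at_top[of R] eventually_ge_at_top[of "char_map \<alpha> v t (R / 2, v (R / 2))"]
proof eventually_elim
  case (elim y)
  from char_map_onto[OF \<alpha> t elim] show ?case
    unfolding foot_def by (simp add: inv_into_into f_inv_into_f)
qed

lemma tendsto_mass_foot: "((\<lambda>y. mass_fn v (fst (foot y))) \<longlongrightarrow> mass_fn v R) at_top"
proof (rule tendstoI)
  fix \<epsilon> :: real assume "\<epsilon> > 0"
  have "v 0 > 0" using pos[of 0] R_pos by simp
  \<comment> \<open>The mass between the foot and \<open>R\<close> will be at most
    \<open>\<delta> * v 0\<close>, hence at most \<open>\<epsilon> / 2\<close>; the bound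
    \<open>R / 2\<close> ensures \<open>\<delta> < R\<close>.\<close>
  define \<delta> where "\<delta> = min (R / 2) (\<epsilon> / (2 * v 0))"
  have \<delta>: "0 < \<delta>" "\<delta> < R"
    using \<open>\<epsilon> > 0\<close> \<open>v 0 > 0\<close> R_pos by (auto simp: \<delta>_def)
  have "\<delta> * v 0 \<le> \<epsilon> / (2 * v 0) * v 0"
    using \<open>v 0 > 0\<close> by (intro mult_right_mono) (auto simp: \<delta>_def)
  also have "\<dots> < \<epsilon>" using \<open>v 0 > 0\<close> \<open>\<epsilon> > 0\<close> by simp
  finally have small: "\<delta> * v 0 < \<epsilon>" .
  show "eventually (\<lambda>y. dist (mass_fn v (fst (foot y))) (mass_fn v R) < \<epsilon>) at_top"
    using eventually_foot
      eventually_gt_at_top[of "R + \<alpha> * mass_fn v R * v (R - \<delta> / 2) powr (\<alpha> - 1) * t"]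
  proof eventually_elim
    case (elim y)
    obtain r e where re: "foot y = (r, e)" by fastforce
    have r: "r > R - \<delta>"
      using char_foot_near_edge[OF \<alpha> t \<delta>, of r e] elim re by auto
    have "r \<le> R" using char_dom_le elim re by auto
    have "mass_fn v R - mass_fn v r \<le> (R - r) * v r"
      using r \<open>r \<le> R\<close> \<delta> by (intro mass_diff_le) auto
    also have "\<dots> \<le> \<delta> * v 0"
      using r \<open>r \<le> R\<close> \<delta> by (intro mult_mono decr nonneg) auto
    also note small
    finally show ?case
      using mass_mono[of r R] r \<open>r \<le> R\<close> \<delta> by (simp add: re dist_real_def)
  qed
qed

lemma tendsto_foot_div: "((\<lambda>y. fst (foot y) / y) \<longlongrightarrow> 0) at_top"
proof (rule tendsto_sandwich[where f = "\<lambda>_. 0" and h = "\<lambda>y. R / y"])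
  show "((\<lambda>y. R / y) \<longlongrightarrow> 0) at_top"
    by (intro tendsto_divide_0[OF tendsto_const] filterlim_at_top_imp_at_infinity filterlim_ident)
  show "eventually (\<lambda>y. fst (foot y) / y \<le> R / y) at_top"
    using eventually_foot eventually_gt_at_top[of 0]
    by eventually_elim (metis char_dom_le divide_right_mono less_imp_le prod.collapse)
  show "eventually (\<lambda>y. 0 \<le> fst (foot y) / y) at_top"
    using eventually_foot eventually_gt_at_top[of 0]
    by eventually_elim (auto simp: char_dom_def case_prod_beta)
qed simp

text \<open>Solve the characteristic equation for \<open>e powr (\<alpha> - 1)\<close> and raise it
  to \<open>\<alpha> / (1 - \<alpha>)\<close>, which turns the exponent into
  \<open>- \<alpha>\<close>. The first factor is a correction tending to 1; the second is the term
  of the self-similar profile.\<close>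

lemma eventually_foot_powr:
  "eventually (\<lambda>y. snd (foot y) powr (- \<alpha>) =
     ((1 - fst (foot y) / y) * (mass_fn v R / mass_fn v (fst (foot y)))) powr (\<alpha> / (1 - \<alpha>)) *
     (y / (\<alpha> * mass_fn v R * t)) powr (\<alpha> / (1 - \<alpha>))) at_top"
  using eventually_foot eventually_gt_at_top[of R]
proof eventually_elim
  case (elim y)
  let ?q = "\<alpha> / (1 - \<alpha>)"
  obtain r e where re: "foot y = (r, e)" by fastforce
  have e: "e > 0" "r \<ge> 0" and eq: "r + \<alpha> * mass_fn v r * e powr (\<alpha> - 1) * t = y" and "r \<le> R"
    using elim re char_dom_le by (auto simp: char_dom_def char_map_def)
  \<comment> \<open>A characteristic carrying no mass would stay at its foot, giving
    \<open>y = r \<le> R\<close> against \<open>y > R\<close>.\<close>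
  have "mass_fn v r \<noteq> 0"
    using eq \<open>r \<le> R\<close> elim by auto
  with e mass_pos[of r] mass_0 have m: "mass_fn v r > 0"
    by (cases "r = 0") auto
  have "y > 0" using elim R_pos by simp
  have M: "mass_fn v R > 0" using mass_pos R_pos by simp
  have "e powr (\<alpha> - 1) = (y - r) / (\<alpha> * mass_fn v r * t)"
    using eq m \<alpha> t by (simp add: field_simps)
  also have "\<dots> = ((1 - r / y) * (mass_fn v R / mass_fn v r)) * (y / (\<alpha> * mass_fn v R * t))"
    using \<open>y > 0\<close> m M \<alpha> t by (simp add: field_simps)
  finally have "(e powr (\<alpha> - 1)) powr ?q = 
      (((1 - r / y) * (mass_fn v R / mass_fn v r)) * (y / (\<alpha> * mass_fn v R * t))) powr ?q"
    by simp
  also have "\<dots> = ((1 - r / y) * (mass_fn v R / mass_fn v r)) powr ?q *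
      (y / (\<alpha> * mass_fn v R * t)) powr ?q"
    by (rule powr_mult)
  also have "(e powr (\<alpha> - 1)) powr ?q = e powr (- \<alpha>)"
  proof -
    have "(\<alpha> - 1) * ?q = - \<alpha>" using \<alpha> by (simp add: field_simps)
    then show ?thesis by (simp add: powr_powr)
  qed
  finally show ?case by (simp add: re)
qed

text \<open>Dividing both bases by the growing term \<open>B\<close> leaves
  \<open>E + \<alpha> * t / B\<close> over \<open>1 + \<alpha> * t / B\<close>, where
  \<open>E\<close> tends to 1 and \<open>B\<close> to infinity. The common power
  \<open>- 1 / \<alpha>\<close> is continuous at 1.\<close>

lemma fan_ratio_tendsto:
  "((\<lambda>y. (snd (foot y) powr (- \<alpha>) + \<alpha> * t) powr (- 1 / \<alpha>) /
      ((y / (\<alpha> * mass_fn v R * t)) powr (\<alpha> / (1 - \<alpha>)) + \<alpha> * t) powr (- 1 / \<alpha>)) \<longlongrightarrow> 1) at_top"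
proof -
  let ?q = "\<alpha> / (1 - \<alpha>)"
  let ?M = "mass_fn v R"
  define E where "E = (\<lambda>y. ((1 - fst (foot y) / y) * (?M / mass_fn v (fst (foot y)))) powr ?q)"
  define B where "B = (\<lambda>y. (y / (\<alpha> * ?M * t)) powr ?q)"
  have M: "?M > 0" using mass_pos R_pos by simp
  have q: "?q > 0" using \<alpha> by simp
  have E_nonneg: "E y \<ge> 0" for y by (simp add: E_def)
  have "(E \<longlongrightarrow> ((1 - 0) * (?M / ?M)) powr ?q) at_top"
    unfolding E_def using M
    by (intro tendsto_intros tendsto_foot_div tendsto_mass_foot) auto
  then have E: "(E \<longlongrightarrow> 1) at_top" using M by simp
  have "filterlim (\<lambda>y. 1 / (\<alpha> * ?M * t) * y) at_top at_top"
    using \<alpha> M t by (intro filterlim_tendsto_pos_mult_at_top[OF tendsto_const] filterlim_ident) auto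
  then have lin: "filterlim (\<lambda>y. y / (\<alpha> * ?M * t)) at_top at_top" by simp
  have "filterlim B at_top at_top"
    unfolding B_def by (rule filterlim_compose[OF real_powr_at_top[OF q] lin])
  then have B: "((\<lambda>y. \<alpha> * t / B y) \<longlongrightarrow> 0) at_top"
    by (intro tendsto_divide_0[OF tendsto_const] filterlim_at_top_imp_at_infinity)
  have "((\<lambda>y. ((E y + \<alpha> * t / B y) / (1 + \<alpha> * t / B y)) powr (- 1 / \<alpha>)) \<longlongrightarrow>
      ((1 + 0) / (1 + 0)) powr (- 1 / \<alpha>)) at_top"
    by (intro tendsto_intros E B) simp_all
  then have "((\<lambda>y. ((E y + \<alpha> * t / B y) / (1 + \<alpha> * t / B y)) powr (- 1 / \<alpha>)) \<longlongrightarrow> 1) at_top"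
    by simp
  then show ?thesis
  proof (rule Lim_transform_eventually)
    show "eventually (\<lambda>y. ((E y + \<alpha> * t / B y) / (1 + \<alpha> * t / B y)) powr (- 1 / \<alpha>) =
      (snd (foot y) powr (- \<alpha>) + \<alpha> * t) powr (- 1 / \<alpha>) /
      ((y / (\<alpha> * ?M * t)) powr ?q + \<alpha> * t) powr (- 1 / \<alpha>)) at_top"
      using eventually_foot_powr eventually_gt_at_top[of 0]
    proof eventually_elim
      case (elim y)
      have "B y > 0" using elim \<alpha> M t by (simp add: B_def)
      then have "(E y + \<alpha> * t / B y) / (1 + \<alpha> * t / B y) = (E y * B y + \<alpha> * t) / (B y + \<alpha> * t)"
        using \<alpha> t by (simp add: divide_simps add_nonneg_eq_0_iff)
      then show ?case
        using elim(1) \<open>B y > 0\<close> E_nonneg[of y] \<alpha> t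
        by (simp add: powr_divide E_def B_def)
    qed
  qed
qed

end
end

section \<open>The self-similar profile, the datum and the conclusion\<close>

lemma selfsim_profile_eq:
  fixes x :: "'a::euclidean_space"
  assumes "0 < \<alpha>" "\<alpha> < 1" "t > 0" "M > 0"
  shows "selfsim_profile \<alpha> M t x =
    ((vol_coord x / (\<alpha> * M * t)) powr (\<alpha> / (1 - \<alpha>)) + \<alpha> * t) powr (- 1 / \<alpha>)"
proof -
  let ?q = "\<alpha> / (1 - \<alpha>)"
  let ?y = "vol_coord x"
  have "(?y * t powr (- 1 / \<alpha>) / (\<alpha> * M)) powr ?q =
      (?y / (\<alpha> * M * t) * t powr (1 - 1 / \<alpha>)) powr ?q"
  proof -
    have "t powr (1 - 1 / \<alpha>) = t * t powr (- 1 / \<alpha>)"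
      using powr_add[of t 1 "- 1 / \<alpha>"] assms by simp
    then show ?thesis using assms by simp
  qed
  also have "\<dots> = (?y / (\<alpha> * M * t)) powr ?q * (t powr (1 - 1 / \<alpha>)) powr ?q"
    by (rule powr_mult)
  \<comment> \<open>The exponents multiply to -1. The outer \<open>t powr (- 1 / \<alpha>)\<close>
    enters the base as a factor \<open>t\<close>, which cancels this \<open>1 / t\<close> and turns
    \<open>\<alpha>\<close> into \<open>\<alpha> * t\<close>, as in the fan formula.\<close>
  also have "(t powr (1 - 1 / \<alpha>)) powr ?q = 1 / t"
  proof -
    have "(1 - 1 / \<alpha>) * ?q = - 1" using assms by (simp add: field_simps)
    then show ?thesis using assms by (simp only: powr_powr) (simp add: powr_minus divide_simps)
  qed
  finally have "selfsim_profile \<alpha> M t x =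
      (t * (\<alpha> + (?y / (\<alpha> * M * t)) powr ?q * (1 / t))) powr (- 1 / \<alpha>)"
    unfolding selfsim_profile_def by (simp add: powr_mult)
  then show ?thesis using assms by (simp add: algebra_simps)
qed

lemma compact_profile_of_datum:
  fixes u0 :: "'a::euclidean_space \<Rightarrow> real"
  assumes "compact K" "AE x in lebesgue. x \<notin> K \<longrightarrow> u0 x = 0"
    and "AE x in lebesgue. 0 \<le> u0 x"
    and "\<not> (AE x in lebesgue. u0 x = 0)"
    and "radial_profile v u0"
  shows "\<exists>R. compact_profile v R"
proof -
  have anti: "antimono_on {0..} v" and eq: "AE x in lebesgue. u0 x = v (vol_coord x)"
    using assms(5) by (auto simp: radial_profile_def)
  have decr: "v b \<le> v a" if "0 \<le> a" "a \<le> b" for a b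
    using anti that by (auto simp: monotone_on_def)
  have nonneg: "v s \<ge> 0" if "s \<ge> 0" for s
  proof -
    have "AE x in lebesgue. v (vol_coord (x::'a)) \<ge> 0"
      using assms(3) eq by eventually_elim simp
    from ex_vol_coord_gt[OF this, of s] that decr[of s] show ?thesis
      by (meson less_imp_le order_trans)
  qed
  define S where "S = {s. 0 \<le> s \<and> v s > 0}"
  obtain b where b: "\<And>x. x \<in> K \<Longrightarrow> vol_coord x \<le> b"
  proof -
    have "continuous_on K (vol_coord :: 'a \<Rightarrow> real)"
      unfolding vol_coord_def by (intro continuous_intros)
    from compact_continuous_image[OF this assms(1)] have "bdd_above (vol_coord ` K)"
      by (simp add: bounded_imp_bdd_above compact_imp_bounded)
    then show ?thesis using that by (auto simp: bdd_above_def)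
  qed
  have "AE x in lebesgue. (x::'a) \<notin> K \<longrightarrow> v (vol_coord x) = 0"
    using assms(2) eq by eventually_elim simp
  \<comment> \<open>A point beyond \<open>K\<close> where the representative vanishes: monotonicity
    then bounds \<open>S\<close> by its volume coordinate.\<close>
  then obtain z :: 'a where "b < vol_coord z" "z \<notin> K \<longrightarrow> v (vol_coord z) = 0"
    using ex_vol_coord_gt by blast
  with b have z: "v (vol_coord z) = 0" by force
  have S_le: "s \<le> vol_coord z" if "s \<in> S" for s
    using that z decr[of "vol_coord z" s] vol_coord_nonneg[of z] unfolding S_def by force
  \<comment> \<open>A profile positive at most at 0 would make \<open>u0\<close> vanish off the
    origin almost everywhere, contradicting that it is not identically zero.\<close>
  have "\<exists>s\<in>S. s > 0"
  proof (rule ccontr)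
    assume none: "\<not> ?thesis"
    have "AE x in lebesgue. x \<noteq> (0::'a)"
      using negligible_sing[of "0::'a"] by (intro AE_I'[of "{0}"]) (auto simp: negligible_iff_null_sets)
    with eq have "AE x in lebesgue. u0 x = 0"
    proof eventually_elim
      case (elim x)
      from elim(2) have "0 < vol_coord x" by (rule vol_coord_pos)
      moreover from this none have "vol_coord x \<notin> S" by blast
      ultimately show ?case
        using nonneg[of "vol_coord x"] elim(1) by (simp add: S_def)
    qed
    with assms(4) show False by blast
  qed
  then obtain p where p: "p \<in> S" "p > 0" by blast
  have bdd: "bdd_above S" using S_le by (intro bdd_aboveI)
  have "compact_profile v (Sup S)"
  proof
    show "Sup S > 0" using cSup_upper[OF p(1) bdd] p(2) by simp
    show "v s > 0" if s: "0 \<le> s" "s < Sup S" for s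
    proof -
      obtain r where "r \<in> S" "s < r" using less_cSupD[of S s] p(1) s(2) by blast
      then show ?thesis using decr[of s r] s(1) by (simp add: S_def)
    qed
    show "v s = 0" if "s > Sup S" for s
      using cSup_upper[OF p(1) bdd] cSup_upper[OF _ bdd, of s] that p(2) nonneg[of s]
      by (force simp: S_def)
  qed (rule anti)
  then show ?thesis ..
qed

lemma integral_radial_profile:
  fixes u0 :: "'a::euclidean_space \<Rightarrow> real"
  assumes "compact_profile v R" "u0 \<in> borel_measurable lebesgue" "radial_profile v u0"
  shows "(LINT x|lebesgue. \<bar>u0 x\<bar>) = mass_fn v R"
proof -
  interpret compact_profile v R by fact
  have meas: "(\<lambda>s. indicator {0..} s * v s) \<in> borel_measurable borel"
    using borel_measurable_cut[of "{0..}"] by simp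
  have "(\<lambda>x::'a. indicator {0..} (vol_coord x) * v (vol_coord x)) \<in> borel_measurable lborel"
    using measurable_compose[OF borel_measurable_vol_coord meas] by simp
  then have meas': "(\<lambda>x::'a. v (vol_coord x)) \<in> borel_measurable lborel"
    by (simp add: vol_coord_nonneg)
  \<comment> \<open>\<open>u0\<close> is only Lebesgue measurable; its Borel representative takes
    over first, so that the integral can be moved to \<open>lborel\<close>.\<close>
  have "(LINT x|lebesgue. \<bar>u0 x\<bar>) = (LINT x::'a|lebesgue. v (vol_coord x))"
  proof (rule integral_cong_AE)
    have "AE x in lebesgue. u0 x = v (vol_coord x)"
      using assms(3) by (simp add: radial_profile_def)
    then show "AE x in lebesgue. \<bar>u0 x\<bar> = v (vol_coord x)"
      by eventually_elim (simp add: nonneg vol_coord_nonneg)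
    show "(\<lambda>x::'a. v (vol_coord x)) \<in> borel_measurable lebesgue"
      using meas' by (rule measurable_completion)
  qed (use assms(2) in simp)
  also have "\<dots> = (LINT x::'a|lborel. v (vol_coord x))"
    using meas' by (rule integral_completion)
  also have "\<dots> = mass_fn v R"
    unfolding total_eq by (rule integral_radial[OF meas])
  finally show ?thesis .
qed

theorem theorem4p10:
  fixes u0 :: "'a::euclidean_space \<Rightarrow> real" and v :: "real \<Rightarrow> real" and \<alpha> M t :: real
  assumes "0 < \<alpha>" and "\<alpha> < 1"
    and "u0 \<in> borel_measurable lebesgue"
    and "\<exists>C. AE x in lebesgue. \<bar>u0 x\<bar> \<le> C"
    and "\<exists>K. compact K \<and> (AE x in lebesgue. x \<notin> K \<longrightarrow> u0 x = 0)"
    and "AE x in lebesgue. 0 \<le> u0 x"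
    and "\<not> (AE x in lebesgue. u0 x = 0)"
    and "radial_profile v u0"
    and "M = (LINT x|lebesgue. \<bar>u0 x\<bar>)"
    and "t > 0"
  shows "((\<lambda>x::'a. (fan_solution \<alpha> v t x - selfsim_profile \<alpha> M t x) / selfsim_profile \<alpha> M t x)
           \<longlongrightarrow> 0) at_infinity"
proof -
  obtain R where R: "compact_profile v R"
    using compact_profile_of_datum assms(5-8) by blast
  interpret compact_profile v R by fact
  have M: "M = mass_fn v R"
    using integral_radial_profile[OF R assms(3,8)] assms(9) by simp
  have "M > 0" using mass_pos R_pos M by simp
  note selfsim = selfsim_profile_eq[OF assms(1,2,10) \<open>M > 0\<close>]
  have U: "selfsim_profile \<alpha> M t x > 0" for x :: 'a
    unfolding selfsim using assms(1,10)
    by (simp add: add_nonneg_pos[THEN less_imp_neq, THEN not_sym])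
  \<comment> \<open>Both functions depend on \<open>x\<close> through \<open>vol_coord x\<close>
    alone, which tends to infinity with the norm, so the one-dimensional limit can be composed with
    it.\<close>
  have "((\<lambda>x::'a. fan_solution \<alpha> v t x / selfsim_profile \<alpha> M t x) \<longlongrightarrow> 1) at_infinity"
    using filterlim_compose[OF fan_ratio_tendsto[OF assms(1,2,10)] vol_coord_at_top]
    unfolding selfsim fan_solution_def by (simp add: case_prod_beta M)
  from tendsto_diff[OF this tendsto_const[of 1]] show ?thesis
    using U by (simp add: diff_divide_distrib less_imp_neq[THEN not_sym])
qed

end
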